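(* Let $\mathcal{RM}(\alpha_1,\ldots,\alpha_n)$ be a bi-rainbow meander, $n\ge 2$, and $\alpha=\sum_{\ell=1}^n\alpha_\ell$. The number $\mathcal{Z}$ of connected components satisfies the following recursion (the first applicable case is used): $$\mathcal{Z}(\alpha_1,\alpha_2,\ldots,\alpha_{n-1},\alpha_n)=\begin{cases} \mathcal{Z}(\alpha_n,\alpha_{n-1},\ldots,\alpha_2,\alpha_1), & \alpha_1>\alpha_n,\\ \mathcal{Z}(\alpha_2,\ldots,\alpha_{n-1})+\alpha_1, & \alpha_1=\alpha_n,\\ \mathcal{Z}\bigl(\mathscr{R}(\alpha_1,\alpha_n-\alpha_1),\alpha_2,\ldots,\alpha_{n-1},\alpha_n-\alpha_1+\mathscr{R}(\alpha_1,\alpha_n-\alpha_1)\bigr), & \alpha_1<\alpha_n<2\alpha_1,\\ \mathcal{Z}(\alpha_2,\ldots,\alpha_{n-1},\alpha_1), & 2\alpha_1=\alpha_n,\\ \mathcal{Z}(\alpha_2,\ldots,\alpha_{n-1},\alpha_1,\alpha_n-2\alpha_1), & 2\alpha_1<\alpha_n<\tfrac23\alpha,\\ \mathcal{Z}(\alpha_1,\alpha_2,\ldots,\alpha_{n-1}), & 2(\alpha-\alpha_n)\mid\alpha_n,\\ \mathcal{Z}\bigl(\alpha_1,\alpha_2,\ldots,\alpha_{n-1},\mathscr{R}(\alpha_n,2(\alpha-\alpha_n))\bigr), & \text{otherwise.} \end{cases}$$ Iterating this recursion gives an algorithm that determines the number $\mathcal{Z}(\alpha_1,\ldots,\alpha_n)$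 with logarithmic complexity $\mathcal{O}(b)\,\mathcal{O}(n)$, where $b=\sum_{\ell=1}^n\lceil\log_2(\alpha_\ell+1)\rceil$ is the number of bits needed to encode the input $(\alpha_1,\ldots,\alpha_n)$.
   Context: For positive integers $\alpha_1,\ldots,\alpha_n$ put $\alpha=\sum_{\ell=1}^n\alpha_\ell$. The bi-rainbow meander $\mathcal{RM}(\alpha_1,\ldots,\alpha_n)$ is the planar configuration of arcs with endpoints at the points $1,2,\ldots,2\alpha$ of the horizontal axis, defined as follows. Above the axis there are $n$ rainbow families of nested arcs: with $s_\ell=2\sum_{k<\ell}\alpha_k$, the $\ell$-th family consists of the $\alpha_\ell$ arcs joining $s_\ell+i$ with $s_\ell+2\alpha_\ell+1-i$, $i=1,\ldots,\alpha_\ell$. Below the axis there is one rainbow family of $\alpha$ nested arcs, joining $k$ with $2\alpha+1-k$, $k=1,\ldots,\alpha$. The union of all upper and lower arcs is a disjoint union of closed Jordan curves; $\mathcal{Z}(\alpha_1,\ldots,\alpha_n)$ denotes the number of these curves (connected components). Equivalently, it is the number of orbits on $\{1,\ldots,2\alpha\}$ of the group generated by the two involutions given by the upper and by the lower arcs. Conventions: $\mathcal{Z}$ of the empty tuple is $0$, and $\mathcal{Z}(\alpha_1)=\alpha_1$; the recursion terminates at tuples of length at most $1$. Zero entries in a tuple (families with no arcs) are removed. $\mathscr{R}(a,c)$ denotes the remainder of the integer division $a/c$, $0\le\mathscr{R}(a,c)<c$. Complexity is measured by counting elementary integer operations (comparison, addition, subtraction, division with remainder), each assumed to cost $\mathcal{O}(1)$;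 the cost of arithmetic with large integers is not considered. *)

theory Defs
  imports Complex_Main "HOL-Algebra.Group_Action" "HOL-Algebra.Generated_Groups"
begin

section \<open>Bi-rainbow meanders\<close>

text \<open>A tuple is a list of natural numbers; list positions are counted from 0. An arc is given by
  the set of its two endpoints.\<close>

definition meander_points :: "nat list \<Rightarrow> nat set" where
  "meander_points as = {1..2 * sum_list as}"

definition upper_arcs :: "nat list \<Rightarrow> nat set set" where
  "upper_arcs as =
     {{2 * sum_list (take l as) + i, 2 * sum_list (take l as) + 2 * as ! l + 1 - i} | l i.
        l < length as \<and> i \<in> {1..as ! l}}"

definition lower_arcs :: "nat list \<Rightarrow> nat set set" where
  "lower_arcs as = {{k, 2 * sum_list as + 1 - k} | k. k \<in> {1..sum_list as}}"

text \<open>The map exchanging the endpoints of each arc. It is undefined outside \<open>P\<close>, as membership in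
  \<^const>\<open>BijGroup\<close> requires.\<close>

definition arc_involution :: "nat set \<Rightarrow> nat set set \<Rightarrow> nat \<Rightarrow> nat" where
  "arc_involution P arcs = (\<lambda>k\<in>P. THE j. {k, j} \<in> arcs)"

definition meander_group :: "nat list \<Rightarrow> (nat \<Rightarrow> nat) monoid" where
  "meander_group as = (let P = meander_points as in
     (BijGroup P)\<lparr>carrier := generate (BijGroup P)
        {arc_involution P (upper_arcs as), arc_involution P (lower_arcs as)}\<rparr>)"

definition meander_components :: "nat list \<Rightarrow> nat" where
  "meander_components as = card (orbits (meander_group as) (meander_points as) (\<lambda>g. g))"

abbreviation remove_zeros :: "nat list \<Rightarrow> nat list" where
  "remove_zeros as \<equiv> filter (\<lambda>x. x \<noteq> 0) as"

definition input_bits :: "nat list \<Rightarrow> nat" where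
  "input_bits as = (\<Sum>x\<leftarrow>as. nat \<lceil>log 2 (real x + 1)\<rceil>)"


section \<open>Counting elementary integer operations\<close>

text \<open>A computation returns its result together with the number of elementary integer operations
  performed, or \<^const>\<open>None\<close> if it does not terminate. All arithmetic and all comparisons of the
  algorithm go through the unit-cost primitives below.\<close>

type_synonym 'a counted = "('a \<times> nat) option"

definition counted_return :: "'a \<Rightarrow> 'a counted" where
  "counted_return x = Some (x, 0)"

definition counted_bind :: "'a counted \<Rightarrow> ('a \<Rightarrow> 'b counted) \<Rightarrow> 'b counted" where
  "counted_bind m f =
     Option.bind m (\<lambda>xt. Option.bind (f (fst xt)) (\<lambda>yu. Some (fst yu, snd xt + snd yu)))"

syntax "_counted_bind" :: "pttrn \<Rightarrow> 'a \<Rightarrow> 'b \<Rightarrow> 'b"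
  ("(with _ \<leftarrow> _;//_)" [0, 11, 10] 10)
translations "_counted_bind x m t" \<rightleftharpoons> "CONST counted_bind m (\<lambda>x. t)"

lemma counted_bind_mono [partial_function_mono]:
  assumes "mono_option A" and "\<And>y. mono_option (\<lambda>f. B y f)"
  shows "mono_option (\<lambda>f. counted_bind (A f) (\<lambda>y. B y f))"
  unfolding counted_bind_def
  by (intro bind_mono assms option.const_mono)

definition op_less :: "nat \<Rightarrow> nat \<Rightarrow> bool counted" where "op_less x y = Some (x < y, 1)"
definition op_eq :: "nat \<Rightarrow> nat \<Rightarrow> bool counted" where "op_eq x y = Some (x = y, 1)"
definition op_add :: "nat \<Rightarrow> nat \<Rightarrow> nat counted" where "op_add x y = Some (x + y, 1)"
definition op_sub :: "nat \<Rightarrow> nat \<Rightarrow> nat counted" where "op_sub x y = Some (x - y, 1)"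
definition op_mod :: "nat \<Rightarrow> nat \<Rightarrow> nat counted" where "op_mod x y = Some (x mod y, 1)"

fun counted_sum :: "nat list \<Rightarrow> nat counted" where
  "counted_sum [] = counted_return 0"
| "counted_sum (x # xs) = (with s \<leftarrow> counted_sum xs; op_add x s)"


section \<open>The algorithm\<close>

text \<open>The argument \<open>s\<close> of the iteration is the sum of the current tuple. It is updated along with
  the tuple and not recomputed, so that each step of the recursion performs a bounded number of
  integer operations. (The number of steps is not \<open>O(b)\<close> in general, so recomputing the sum of
  \<open>n\<close> entries at each step would be too expensive.)

  Rearranging the tuple is not an integer operation. The rearrangements used are reversal and
  insertion or removal of boundedly many entries at the two ends. A remainder can vanish, and hence
  an entry has to be removed, in the third case and in the next-to-last one.\<close>

partial_function (option) meander_iterate :: "nat list \<Rightarrow> nat \<Rightarrow> nat counted" where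
  "meander_iterate as s =
    (case as of
       [] \<Rightarrow> counted_return 0
     | a # bs \<Rightarrow>
       (if bs = [] then counted_return a
        else (let xs = butlast bs; c = last bs in
          with flip \<leftarrow> op_less c a;
          if flip then meander_iterate (c # rev xs @ [a]) s
          else
          with same \<leftarrow> op_eq a c;
          with aa \<leftarrow> op_add a a;
          if same then
            with s' \<leftarrow> op_sub s aa;
            with z \<leftarrow> meander_iterate xs s';
            op_add z a
          else
          with short \<leftarrow> op_less c aa;
          if short then
            with d \<leftarrow> op_sub c a;
            with r \<leftarrow> op_mod a d;
            with c' \<leftarrow> op_add d r;
            with s1 \<leftarrow> op_sub s a;
            with s2 \<leftarrow> op_sub s1 c;
            with s3 \<leftarrow> op_add s2 r;
            with s' \<leftarrow> op_add s3 c';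
            with vanishes \<leftarrow> op_eq r 0;
            meander_iterate (if vanishes then xs @ [c'] else r # xs @ [c']) s'
          else
          with double \<leftarrow> op_eq aa c;
          if double then
            with s' \<leftarrow> op_sub s c;
            meander_iterate (xs @ [a]) s'
          else
          with cc \<leftarrow> op_add c c;
          with ccc \<leftarrow> op_add cc c;
          with ss \<leftarrow> op_add s s;
          with medium \<leftarrow> op_less ccc ss;
          if medium then
            with c' \<leftarrow> op_sub c aa;
            with s' \<leftarrow> op_sub s aa;
            meander_iterate (xs @ [a, c']) s'
          else
          with t \<leftarrow> op_sub s c;
          with tt \<leftarrow> op_add t t;
          with r \<leftarrow> op_mod c tt;
          with divides \<leftarrow> op_eq r 0;
          if divides then meander_iterate (a # xs) t
          else
            with s' \<leftarrow> op_add t r;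
            meander_iterate (a # xs @ [r]) s')))"

definition meander_algorithm :: "nat list \<Rightarrow> nat counted" where
  "meander_algorithm as = (with s \<leftarrow> counted_sum as; meander_iterate as s)"

end

theory Submission
  imports Defs
begin

text \<open>The number of components is the number of classes of points under the two arc involutions, so
  it can be compared between two meanders by maps of points that respect these classes. One
  reduction carries the recursion: let \<open>a < c\<close>, \<open>d = c - a\<close> and \<open>r = a mod d\<close>. On the last rainbow
  of \<open>(a, xs, c)\<close> a detour through the first rainbow acts as the translation by \<open>2 * d\<close>, so the last
  rainbow may be replaced by its first \<open>2 * d\<close> points, on which the upper arcs induce the two
  rainbows \<open>r\<close> and \<open>d - r\<close>. Hence \<open>(a, xs, c)\<close> and \<open>(xs, r, d - r)\<close> have equally many components.
  Applied to both sides of the third case it gives the same tuple; for \<open>2 * a \<le> c\<close> it is the rotation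
  to \<open>(xs, a, c - 2 * a)\<close>; and rotating once through all other entries, whose sum is \<open>R\<close>, lowers \<open>c\<close>
  by \<open>2 * R\<close>, whence the last two cases.

  For the complexity let \<open>\<Psi> = 2 * B - b\<close>, where \<open>B\<close> is the total number of bits and \<open>b\<close> that of the
  last entry. No step increases \<open>\<Psi>\<close>. All steps decrease it except rotations and those flips
  \<open>(a, xs, c) \<mapsto> (c, rev xs, a)\<close> with \<open>a \<le> 2 * c\<close>, after which a rotation is impossible. Between two
  decreases of \<open>\<Psi>\<close> the last entry can rotate past fewer than \<open>n\<close> others, so there are \<open>O(n * B)\<close>
  steps.\<close>

section \<open>Classes under two involutions\<close>

text \<open>Only forward steps are generated: where both maps are involutions each step is its own
  inverse, so this is already the orbit relation of the group they generate.\<close>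

inductive linked :: "('a \<Rightarrow> 'a) \<Rightarrow> ('a \<Rightarrow> 'a) \<Rightarrow> 'a \<Rightarrow> 'a \<Rightarrow> bool" for f g where
  linked_refl [intro!, simp]: "linked f g x x"
| linked_left: "linked f g x y \<Longrightarrow> linked f g x (f y)"
| linked_right: "linked f g x y \<Longrightarrow> linked f g x (g y)"

definition n_comps :: "'a set \<Rightarrow> ('a \<Rightarrow> 'a) \<Rightarrow> ('a \<Rightarrow> 'a) \<Rightarrow> nat" where
  "n_comps P f g = card ((\<lambda>x. Collect (linked f g x)) ` P)"

definition involution_on :: "'a set \<Rightarrow> ('a \<Rightarrow> 'a) \<Rightarrow> bool" where
  "involution_on P f \<longleftrightarrow> (\<forall>x\<in>P. f x \<in> P \<and> f (f x) = x)"

lemma linked_trans [trans]: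
  assumes "linked f g x y" "linked f g y z"
  shows "linked f g x z"
  using assms(2,1) by (induction rule: linked.induct) (auto intro: linked.intros)

lemma linked_step_left: "linked f g x (f x)"
  and linked_step_right: "linked f g x (g x)"
  by (auto intro: linked.intros)

lemma linked_in:
  assumes "linked f g x y" "x \<in> P" "involution_on P f" "involution_on P g"
  shows "y \<in> P"
  using assms by (induction rule: linked.induct) (auto simp: involution_on_def)

lemma linked_sym:
  assumes "linked f g x y" "x \<in> P" and inv: "involution_on P f" "involution_on P g"
  shows "linked f g y x"
  using assms(1,2)
proof (induction rule: linked.induct)
  case (linked_left x y)
  then have "y \<in> P" using linked_in inv by metis
  then have "linked f g (f y) y"
    using linked_step_left[of f g "f y"] inv by (auto simp: involution_on_def)
  then show ?case using linked_left linked_trans by metis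
next
  case (linked_right x y)
  then have "y \<in> P" using linked_in inv by metis
  then have "linked f g (g y) y"
    using linked_step_right[of f g "g y"] inv by (auto simp: involution_on_def)
  then show ?case using linked_right linked_trans by metis
qed simp

lemma Collect_linked_eq_iff:
  assumes "x \<in> P" "y \<in> P" "involution_on P f" "involution_on P g"
  shows "Collect (linked f g x) = Collect (linked f g y) \<longleftrightarrow> linked f g x y"
  using assms linked_sym linked_trans linked_refl
  by (smt (verit, best) Collect_cong mem_Collect_eq)

text \<open>A single step may become a whole path in the image. The path from \<open>x\<close> stays
  in \<open>P\<close>, so the step hypotheses remain available along it.\<close>

lemma linked_map:
  assumes "linked f g x y" "x \<in> P" "involution_on P f" "involution_on P g"
    and "\<And>x. x \<in> P \<Longrightarrow> linked f' g' (h x) (h (f x))"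
    and "\<And>x. x \<in> P \<Longrightarrow> linked f' g' (h x) (h (g x))"
  shows "linked f' g' (h x) (h y)"
  using assms
proof (induction rule: linked.induct)
  case (linked_left x y)
  then show ?case using linked_in[of f g x y P] linked_trans[of f' g' "h x" "h y"] by blast
next
  case (linked_right x y)
  then show ?case using linked_in[of f g x y P] linked_trans[of f' g' "h x" "h y"] by blast
qed simp

text \<open>Both images are in bijection with the set of common fibres.\<close>

lemma card_image_eq_kernel:
  assumes "\<And>x y. x \<in> A \<Longrightarrow> y \<in> A \<Longrightarrow> f x = f y \<longleftrightarrow> g x = g y"
  shows "card (f ` A) = card (g ` A)"
proof -
  have "g (inv_into A f (f x)) = g x" if "x \<in> A" for x
    using assms[of "inv_into A f (f x)" x] that by (simp add: f_inv_into_f inv_into_into)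
  then have "bij_betw (\<lambda>C. g (inv_into A f C)) (f ` A) (g ` A)"
    using assms by (auto simp: bij_betw_def inj_on_def image_image)
  then show ?thesis by (rule bij_betw_same_card)
qed

text \<open>By \<open>linked_map\<close> both maps descend to classes. \<open>\<phi>\<close> undoes
  \<open>\<psi>\<close> exactly, so \<open>\<psi>\<close> is injective on classes; it reaches every
  class because \<open>\<psi> (\<phi> x)\<close> stays in the class of \<open>x\<close>. The
  asymmetry fits retractions of a point set onto a smaller one.\<close>

lemma n_comps_transfer:
  assumes inv: "involution_on P f" "involution_on P g"
    and inv': "involution_on P' f'" "involution_on P' g'"
    and \<phi>: "\<And>x. x \<in> P \<Longrightarrow> \<phi> x \<in> P'"
      "\<And>x. x \<in> P \<Longrightarrow> linked f' g' (\<phi> x) (\<phi> (f x))"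
      "\<And>x. x \<in> P \<Longrightarrow> linked f' g' (\<phi> x) (\<phi> (g x))"
    and \<psi>: "\<And>y. y \<in> P' \<Longrightarrow> \<psi> y \<in> P"
      "\<And>y. y \<in> P' \<Longrightarrow> linked f g (\<psi> y) (\<psi> (f' y))"
      "\<And>y. y \<in> P' \<Longrightarrow> linked f g (\<psi> y) (\<psi> (g' y))"
    and \<psi>\<phi>: "\<And>x. x \<in> P \<Longrightarrow> linked f g x (\<psi> (\<phi> x))"
    and \<phi>\<psi>: "\<And>y. y \<in> P' \<Longrightarrow> \<phi> (\<psi> y) = y"
  shows "n_comps P f g = n_comps P' f' g'"
proof -
  let ?c = "\<lambda>x. Collect (linked f g x)" and ?c' = "\<lambda>x. Collect (linked f' g' x)"
  have "?c ` P = ?c ` \<psi> ` P'"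
  proof
    have "?c x = ?c (\<psi> (\<phi> x))" if "x \<in> P" for x
      using Collect_linked_eq_iff[OF that _ inv] \<psi>\<phi> \<phi>(1) \<psi>(1) that by blast
    then have "?c ` P \<subseteq> (\<lambda>x. ?c (\<psi> (\<phi> x))) ` P" by (intro image_subsetI) (rule image_eqI)
    then show "?c ` P \<subseteq> ?c ` \<psi> ` P'" using \<phi>(1) by blast
    show "?c ` \<psi> ` P' \<subseteq> ?c ` P" using \<psi>(1) by blast
  qed
  moreover have "?c (\<psi> x) = ?c (\<psi> y) \<longleftrightarrow> ?c' x = ?c' y" if "x \<in> P'" "y \<in> P'" for x y
  proof -
    have "linked f' g' x y" if "linked f g (\<psi> x) (\<psi> y)"
      using linked_map[of f g "\<psi> x" "\<psi> y" P f' g' \<phi>] that inv \<phi> \<psi>(1) \<phi>\<psi> \<open>x \<in> P'\<close> \<open>y \<in> P'\<close> by simp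
    moreover have "linked f g (\<psi> x) (\<psi> y)" if "linked f' g' x y"
      using linked_map[of f' g' x y P' f g \<psi>] that inv' \<psi> \<open>x \<in> P'\<close> by simp
    ultimately show ?thesis
      using Collect_linked_eq_iff[OF \<psi>(1) \<psi>(1) inv] Collect_linked_eq_iff[OF _ _ inv'] that
      by blast
  qed
  then have "card ((\<lambda>y. ?c (\<psi> y)) ` P') = card (?c' ` P')"
    by (intro card_image_eq_kernel)
  ultimately show ?thesis by (simp add: n_comps_def image_image)
qed

lemma n_comps_cong:
  assumes "involution_on P f" "involution_on P g"
    and "\<And>x. x \<in> P \<Longrightarrow> f' x = f x" "\<And>x. x \<in> P \<Longrightarrow> g' x = g x"
  shows "n_comps P f g = n_comps P f' g'"
proof -
  have inv': "involution_on P f'" "involution_on P g'" using assms by (auto simp: involution_on_def)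
  have "linked f' g' x (f x)" "linked f' g' x (g x)" "linked f g x (f' x)" "linked f g x (g' x)"
    if "x \<in> P" for x
    using linked_step_left[of f g x] linked_step_right[of f g x] linked_step_left[of f' g' x]
      linked_step_right[of f' g' x] assms(3,4)[OF that] by auto
  then show ?thesis
    by (intro n_comps_transfer[where \<phi> = id and \<psi> = id]) (use assms inv' in auto)
qed

lemma n_comps_Un:
  assumes "involution_on A f" "involution_on A g" "involution_on B f" "involution_on B g"
    and "finite A" "finite B" "A \<inter> B = {}"
  shows "n_comps (A \<union> B) f g = n_comps A f g + n_comps B f g"
proof -
  let ?c = "\<lambda>x. Collect (linked f g x)"
  have "?c ` A \<inter> ?c ` B = {}"
    using linked_in[of f g _ _ A] linked_in[of f g _ _ B] assms linked_refl[of f g] 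
    by (smt (verit, best) disjoint_iff image_iff mem_Collect_eq)
  then show ?thesis using assms by (simp add: n_comps_def image_Un card_Un_disjoint)
qed

lemma n_comps_id: "n_comps P id id = card P"
proof -
  have "x = y" if "linked id id x y" for x y :: 'a
    using that by (induction rule: linked.induct) auto
  then have "(\<lambda>x. Collect (linked id id x)) = (\<lambda>x::'a. {x})" by fastforce
  then show ?thesis by (simp add: n_comps_def card_image)
qed

section \<open>Components as classes of points\<close>

text \<open>The other end of the upper arc at \<open>k\<close>, family by family. Points start at 1;
  at \<open>k = 0\<close> the first branch would give \<open>2 * a + 1\<close>, hence the recurring
  assumption \<open>0 < k\<close>.\<close>

fun mate :: "nat list \<Rightarrow> nat \<Rightarrow> nat" where
  "mate [] k = k"
| "mate (a # as) k = (if k \<le> 2 * a then 2 * a + 1 - k else 2 * a + mate as (k - 2 * a))"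

lemma mate_append:
  "0 < k \<Longrightarrow> mate (xs @ ys) k =
    (if k \<le> 2 * sum_list xs then mate xs k else 2 * sum_list xs + mate ys (k - 2 * sum_list xs))"
  by (induction xs arbitrary: k) auto

lemma mate_bounds:
  "0 < k \<Longrightarrow> k \<le> 2 * sum_list as \<Longrightarrow> 0 < mate as k \<and> mate as k \<le> 2 * sum_list as"
  by (induction as arbitrary: k) (fastforce split: if_splits)+

lemma mate_mate:
  "0 < k \<Longrightarrow> k \<le> 2 * sum_list as \<Longrightarrow> mate as (mate as k) = k"
proof (induction as arbitrary: k)
  case (Cons a as)
  show ?case
  proof (cases "k \<le> 2 * a")
    case False
    then have "0 < k - 2 * a" "k - 2 * a \<le> 2 * sum_list as" using Cons.prems by auto
    then show ?thesis using mate_bounds[of "k - 2 * a" as] Cons.IH False by simp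
  qed (use Cons.prems in auto)
qed simp

lemma involution_mate: "involution_on {1..2 * sum_list as} (mate as)"
  unfolding involution_on_def using mate_bounds[of _ as] mate_mate[of _ as] by (simp add: Suc_le_eq)

lemma involution_reflect: "involution_on {1..n} (\<lambda>k. n + 1 - k)" for n :: nat
  by (auto simp: involution_on_def)

lemma mate_remove_zeros: "0 < k \<Longrightarrow> mate (remove_zeros as) k = mate as k"
  by (induction as arbitrary: k) auto

lemma upper_arcs_Nil: "upper_arcs [] = {}"
  by (simp add: upper_arcs_def)

text \<open>Reindexing \<open>l\<close> as \<open>Suc l\<close> adds \<open>a\<close> to every
  prefix sum, so the later families are translated by \<open>2 * a\<close>.\<close>

lemma upper_arcs_Cons:
  "upper_arcs (a # as) = {{i, 2 * a + 1 - i} | i. i \<in> {1..a}} \<union> image ((+) (2 * a)) ` upper_arcs as"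
proof -
  let ?arc = "\<lambda>as l i. {2 * sum_list (take l as) + i, 2 * sum_list (take l as) + 2 * as ! l + 1 - i}"
  have split: "upper_arcs bs = (\<Union>l<length bs. ?arc bs l ` {1..bs ! l})" for bs
    unfolding upper_arcs_def by blast
  have shift: "?arc (a # as) (Suc l) i = (+) (2 * a) ` ?arc as l i" if "i \<in> {1..as ! l}" for l i
    using that by auto
  have "upper_arcs (a # as) = ?arc (a # as) 0 ` {1..a} \<union>
      (\<Union>l<length as. ?arc (a # as) (Suc l) ` {1..as ! l})"
    unfolding split by (simp only: list.size lessThan_Suc_eq_insert_0 add_Suc_right add_0_right) auto
  also have "(\<Union>l<length as. ?arc (a # as) (Suc l) ` {1..as ! l}) =
      (\<Union>l<length as. (\<lambda>i. (+) (2 * a) ` ?arc as l i) ` {1..as ! l})"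
    by (intro SUP_cong image_cong refl shift)
  also have "\<dots> = image ((+) (2 * a)) ` upper_arcs as"
    unfolding split by (simp only: image_UN image_image)
  finally show ?thesis by auto
qed

lemma doubleton_in_upper_arcs_iff:
  "{k, j} \<in> upper_arcs as \<longleftrightarrow> 0 < k \<and> k \<le> 2 * sum_list as \<and> j = mate as k"
proof (induction as arbitrary: k j)
  case Nil
  then show ?case by (auto simp: upper_arcs_Nil)
next
  case (Cons a as)
  have "(\<exists>i. {k, j} = {i, 2 * a + 1 - i} \<and> i \<in> {1..a}) \<longleftrightarrow> 0 < k \<and> k \<le> 2 * a \<and> j = 2 * a + 1 - k"
  proof
    assume "0 < k \<and> k \<le> 2 * a \<and> j = 2 * a + 1 - k"
    then show "\<exists>i. {k, j} = {i, 2 * a + 1 - i} \<and> i \<in> {1..a}"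
      \<comment> \<open>Arcs are indexed by their left endpoints, and \<open>k\<close> may be either
        end.\<close>
      by (intro exI[of _ "min k j"]) (auto simp: min_def)
  qed (auto simp: doubleton_eq_iff)
  moreover have "{k, j} \<in> image ((+) (2 * a)) ` upper_arcs as \<longleftrightarrow>
      2 * a < k \<and> k \<le> 2 * sum_list (a # as) \<and> j = 2 * a + mate as (k - 2 * a)"
  proof
    assume "{k, j} \<in> image ((+) (2 * a)) ` upper_arcs as"
    then obtain A where A: "A \<in> upper_arcs as" "{k, j} = (+) (2 * a) ` A" by blast
    then have "k \<in> (+) (2 * a) ` A" "j \<in> (+) (2 * a) ` A" by auto
    then have kj: "k \<ge> 2 * a" "j \<ge> 2 * a" by auto
    then have "(+) (2 * a) ` A = (+) (2 * a) ` {k - 2 * a, j - 2 * a}" using A(2) by auto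
    then have "A = {k - 2 * a, j - 2 * a}" by (subst (asm) inj_image_eq_iff) auto
    with A(1) Cons.IH kj show "2 * a < k \<and> k \<le> 2 * sum_list (a # as) \<and> j = 2 * a + mate as (k - 2 * a)"
      by auto
  next
    assume *: "2 * a < k \<and> k \<le> 2 * sum_list (a # as) \<and> j = 2 * a + mate as (k - 2 * a)"
    then have "{k - 2 * a, j - 2 * a} \<in> upper_arcs as" by (simp add: Cons.IH) linarith
    moreover have "{k, j} = (+) (2 * a) ` {k - 2 * a, j - 2 * a}" using * by auto
    ultimately show "{k, j} \<in> image ((+) (2 * a)) ` upper_arcs as" by blast
  qed
  ultimately show ?case by (auto simp: upper_arcs_Cons)
qed

lemma doubleton_in_lower_arcs_iff:
  "{k, j} \<in> lower_arcs as \<longleftrightarrow> 0 < k \<and> k \<le> 2 * sum_list as \<and> j = 2 * sum_list as + 1 - k"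
proof
  assume "0 < k \<and> k \<le> 2 * sum_list as \<and> j = 2 * sum_list as + 1 - k"
  then show "{k, j} \<in> lower_arcs as"
    unfolding lower_arcs_def
    by (intro CollectI exI[of _ "min k j"]) (auto simp: min_def)
qed (auto simp: lower_arcs_def doubleton_eq_iff)

text \<open>The generators are their own inverses, so every group element is a word in them and
  moves points along links; conversely, a step along a link is multiplication by a generator on the
  left.\<close>

lemma orbit_generate_involutions:
  assumes inv: "involution_on P f" "involution_on P g" and "x \<in> P"
  shows "{h x | h. h \<in> generate (BijGroup P) {restrict f P, restrict g P}} = Collect (linked f g x)"
    (is "{h x | h. h \<in> ?G} = _")
proof -
  interpret group "BijGroup P" by (rule group_BijGroup)
  have Bij: "restrict u P \<in> Bij P" if "involution_on P u" for u :: "'a \<Rightarrow> 'a"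
    using that
    by (auto simp: Bij_def involution_on_def intro!: bij_betwI[where g = u])
  have inverse: "inv\<^bsub>BijGroup P\<^esub> restrict u P = restrict u P" if "involution_on P u" for u :: "'a \<Rightarrow> 'a"
    using that Bij[OF that]
    by (intro inv_equality) (auto simp: BijGroup_def compose_def involution_on_def fun_eq_iff)
  have sub: "{restrict f P, restrict g P} \<subseteq> carrier (BijGroup P)"
    using inv Bij by (auto simp: BijGroup_def)
  have mult: "(h \<otimes>\<^bsub>BijGroup P\<^esub> k) y = h (k y)" if "h \<in> ?G" "k \<in> ?G" "y \<in> P" for h k y
    using generate_in_carrier[OF sub that(1)] generate_in_carrier[OF sub that(2)] that(3)
    by (simp add: BijGroup_def compose_def)
  have in_G: "restrict f P \<in> ?G" "restrict g P \<in> ?G"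
    by (auto intro: generate.incl)
  have "linked f g y (h y)" if "h \<in> ?G" "y \<in> P" for h y
    using that
  proof (induction arbitrary: y rule: generate.induct)
    case one
    then show ?case by (simp add: BijGroup_def)
  next
    case (incl h)
    then show ?case by (auto intro: linked_step_left linked_step_right)
  next
    case (inv h)
    then show ?case using inverse assms(1,2) by (auto intro: linked_step_left linked_step_right)
  next
    case (eng h1 h2)
    then show ?case
      using linked_in[of f g y "h2 y" P] assms(1,2) linked_trans[of f g y "h2 y" "h1 (h2 y)"]
      by (simp add: mult)
  qed
  moreover have "\<exists>h. y = h x \<and> h \<in> ?G" if "linked f g x y" for y
    using that \<open>x \<in> P\<close>
  proof (induction rule: linked.induct)
    case (linked_refl x)
    have "x = \<one>\<^bsub>BijGroup P\<^esub> x" using linked_refl by (simp add: BijGroup_def)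
    then show ?case using generate.one by blast
  next
    case (linked_left x y)
    then obtain h where h: "y = h x" "h \<in> ?G" by blast
    then have "f y = (restrict f P \<otimes>\<^bsub>BijGroup P\<^esub> h) x"
      using linked_in[OF linked_left.hyps linked_left.prems inv] linked_left.prems
      by (simp add: mult in_G)
    moreover have "restrict f P \<otimes>\<^bsub>BijGroup P\<^esub> h \<in> ?G"
      using h(2) by (intro generate.eng in_G)
    ultimately show ?case by blast
  next
    case (linked_right x y)
    then obtain h where h: "y = h x" "h \<in> ?G" by blast
    then have "g y = (restrict g P \<otimes>\<^bsub>BijGroup P\<^esub> h) x"
      using linked_in[OF linked_right.hyps linked_right.prems inv] linked_right.prems
      by (simp add: mult in_G)
    moreover have "restrict g P \<otimes>\<^bsub>BijGroup P\<^esub> h \<in> ?G"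
      using h(2) by (intro generate.eng in_G)
    ultimately show ?case by blast
  qed
  ultimately show ?thesis using \<open>x \<in> P\<close> by blast
qed

lemma meander_components_eq:
  "meander_components as =
    n_comps {1..2 * sum_list as} (mate as) (\<lambda>k. 2 * sum_list as + 1 - k)"
proof -
  let ?P = "{1..2 * sum_list as}" and ?r = "\<lambda>k. 2 * sum_list as + 1 - k"
  have "arc_involution ?P (upper_arcs as) = restrict (mate as) ?P"
    "arc_involution ?P (lower_arcs as) = restrict ?r ?P"
    by (auto simp: arc_involution_def doubleton_in_upper_arcs_iff doubleton_in_lower_arcs_iff
        intro!: restrict_ext the_equality)
  then have "meander_components as = card ((\<lambda>x. {h x | h.
      h \<in> generate (BijGroup ?P) {restrict (mate as) ?P, restrict ?r ?P}}) ` ?P)"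
    by (simp add: meander_components_def meander_group_def meander_points_def orbits_def orbit_def
        Let_def image_def Bex_def conj_commute)
  then show ?thesis
    unfolding n_comps_def
    using orbit_generate_involutions[OF involution_mate involution_reflect]
    by (metis (no_types, lifting) image_cong)
qed

section \<open>The recursion\<close>

lemma mate_rev:
  "0 < k \<Longrightarrow> k \<le> 2 * sum_list as \<Longrightarrow>
    mate (rev as) k = 2 * sum_list as + 1 - mate as (2 * sum_list as + 1 - k)"
  by (induction as arbitrary: k) (auto simp: mate_append)

text \<open>Reflecting the axis keeps the lower rainbow and reverses the order of the upper
  families.\<close>

lemma meander_components_rev: "meander_components (rev as) = meander_components as"
proof -
  let ?n = "2 * sum_list as"
  let ?r = "\<lambda>k. ?n + 1 - k"
  have "n_comps {1..?n} (mate (rev as)) ?r = n_comps {1..?n} (mate as) ?r"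
  proof (rule n_comps_transfer[where \<phi> = ?r and \<psi> = ?r])
    fix k assume k: "k \<in> {1..?n}"
    show "linked (mate as) ?r (?r k) (?r (mate (rev as) k))"
    proof -
      have "?r (mate (rev as) k) = mate as (?r k)"
        using k mate_rev[of k as] mate_bounds[of "?r k" as] by fastforce
      then show ?thesis by (simp only: linked_step_left)
    qed
    show "linked (mate (rev as)) ?r (?r k) (?r (mate as k))"
    proof -
      have "?r (mate as k) = mate (rev as) (?r k)"
        using k mate_rev[of "?r k" as] by auto
      then show ?thesis by (simp only: linked_step_left)
    qed
    show "linked (mate as) ?r (?r k) (?r (?r k))" "linked (mate (rev as)) ?r (?r k) (?r (?r k))"
      by (rule linked_step_right)+
  qed (use involution_mate[of as] involution_mate[of "rev as"] involution_reflect[of ?n] in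
      \<open>auto simp: sum_list_rev\<close>)
  then show ?thesis by (simp add: meander_components_eq sum_list_rev)
qed

lemma meander_components_remove_zeros:
  "meander_components (remove_zeros as) = meander_components as"
proof -
  have sum: "sum_list (remove_zeros as) = sum_list as" by (induction as) auto
  show ?thesis
    unfolding meander_components_eq sum
    using involution_mate[of "remove_zeros as", unfolded sum] mate_remove_zeros[of _ as]
    by (intro n_comps_cong involution_reflect) auto
qed

lemma meander_components_Nil: "meander_components [] = 0"
  by (simp add: meander_components_eq n_comps_def)

lemma involution_on_subset:
  "involution_on P f \<Longrightarrow> A \<subseteq> P \<Longrightarrow> (\<And>x. x \<in> A \<Longrightarrow> f x \<in> A) \<Longrightarrow> involution_on A f"
  by (auto simp: involution_on_def)

lemma meander_components_single: "meander_components [a] = a"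
proof -
  let ?r = "\<lambda>k. 2 * a + 1 - k"
  \<comment> \<open>Upper and lower arcs coincide, so each component is one pair of endpoints,
    represented by the left one.\<close>
  have "n_comps {1..2 * a} (mate [a]) ?r = n_comps {1..a} id id"
  proof (rule n_comps_transfer[where \<phi> = "\<lambda>k. min k (?r k)" and \<psi> = id])
    fix k assume "k \<in> {1..2 * a}"
    then show "linked (mate [a]) ?r k (id (min k (?r k)))"
      using linked_step_right[of "mate [a]" ?r k] by (auto simp: min_def)
  qed (use involution_mate[of "[a]"] involution_reflect[of "2 * a"] in
      \<open>auto simp: involution_on_def min_def\<close>)
  then show ?thesis by (simp add: meander_components_eq n_comps_id)
qed

text \<open>The outer rainbows (\<open>A\<close>) and the inner families (\<open>B\<close>) are each
  closed under both maps. On \<open>A\<close> the lower arcs identify the two rainbows arc by arc,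
  so each upper arc of the first one yields one component; \<open>B\<close> is a translate of
  \<open>xs\<close>.\<close>

lemma meander_components_equal_ends:
  "meander_components (a # xs @ [a]) = meander_components xs + a"
proof -
  define X where "X = sum_list xs"
  let ?as = "a # xs @ [a]"
  let ?n = "4 * a + 2 * X"
  define f where "f = mate ?as"
  define r where "r k = ?n + 1 - k" for k
  define A where "A = {1..2 * a} \<union> {2 * a + 2 * X + 1..?n}"
  define B where "B = {2 * a + 1..2 * a + 2 * X}"
  have fA: "f k = (if k \<le> 2 * a then 2 * a + 1 - k else 6 * a + 4 * X + 1 - k)" if "k \<in> A" for k
    using that by (auto simp: f_def A_def mate_append X_def)
  have fB: "f k = 2 * a + mate xs (k - 2 * a)" if "k \<in> B" for k
    using that by (auto simp: f_def B_def mate_append X_def)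
  have inv: "involution_on {1..?n} f" "involution_on {1..?n} r"
    using involution_mate[of ?as] involution_reflect[of ?n]
    by (auto simp: f_def r_def[abs_def] X_def algebra_simps)
  have "f k \<in> A" "r k \<in> A" if "k \<in> A" for k
    unfolding fA[OF that] using that by (auto simp: A_def r_def)
  moreover have "A \<subseteq> {1..?n}" "B \<subseteq> {1..?n}" by (auto simp: A_def B_def)
  ultimately have invA: "involution_on A f" "involution_on A r"
    using inv involution_on_subset by metis+
  have fB_in: "f k \<in> B" if "k \<in> B" for k
  proof -
    have "0 < k - 2 * a" "k - 2 * a \<le> 2 * sum_list xs" using that by (auto simp: B_def X_def)
    then show ?thesis using mate_bounds[of "k - 2 * a" xs] by (simp add: fB[OF that] B_def X_def)
  qed
  moreover have "r k \<in> B" if "k \<in> B" for k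
    using that by (auto simp: B_def r_def)
  ultimately have invB: "involution_on B f" "involution_on B r"
    using inv \<open>B \<subseteq> {1..?n}\<close> involution_on_subset by metis+
  have "meander_components ?as = n_comps (A \<union> B) f r"
  proof -
    have "{1..?n} = A \<union> B" by (auto simp: A_def B_def)
    moreover have "2 * sum_list ?as = ?n" by (simp add: X_def)
    ultimately show ?thesis by (simp only: meander_components_eq f_def r_def[abs_def])
  qed
  also have "\<dots> = n_comps A f r + n_comps B f r"
    using invA invB by (intro n_comps_Un) (auto simp: A_def B_def)
  also have "n_comps A f r = n_comps {1..a} id id"
  proof -
    \<comment> \<open>\<open>m\<close> folds the last rainbow onto the first along the lower arcs;
      \<open>\<phi>\<close> then takes the left end of the upper arc. It is thus constant on
      components and maps \<open>A\<close> onto \<open>{1..a}\<close>.\<close>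
    define m where "m k = min k (r k)" for k
    define \<phi> where "\<phi> k = min (m k) (2 * a + 1 - m k)" for k
    have m_in: "1 \<le> m k \<and> m k \<le> 2 * a" if "k \<in> A" for k
      using that by (auto simp: A_def m_def r_def min_def)
    have to_m: "linked f r k (m k)" for k
      using linked_step_right[of f r k] by (auto simp: m_def min_def)
    have "linked f r (m k) (\<phi> k)" if "k \<in> A" for k
      using linked_step_left[of f r "m k"] fA[of "m k"] m_in[OF that]
      by (auto simp: \<phi>_def min_def A_def)
    then have to_\<phi>: "linked f r k (\<phi> k)" if "k \<in> A" for k
      using to_m linked_trans that by metis
    have m_eq: "m k = (if k \<le> 2 * a then k else ?n + 1 - k)" if "k \<in> A" for k
      using that by (auto simp: m_def r_def A_def min_def)
    have "m (f k) = 2 * a + 1 - m k" if "k \<in> A" for k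
    proof -
      have "f k \<in> A" using invA that by (simp add: involution_on_def)
      moreover have "f k \<le> 2 * a \<longleftrightarrow> k \<le> 2 * a" using that by (auto simp: fA A_def)
      moreover have "k \<le> ?n" using that by (auto simp: A_def)
      ultimately show ?thesis using that by (auto simp: m_eq fA)
    qed
    then have "\<phi> (f k) = \<phi> k" if "k \<in> A" for k
      using m_in[OF that] that by (simp add: \<phi>_def min.commute)
    moreover have "\<phi> (r k) = \<phi> k" if "k \<in> A" for k
    proof -
      have "r (r k) = k" using that invA by (simp add: involution_on_def)
      then show ?thesis by (simp add: \<phi>_def m_def min.commute)
    qed
    moreover have "\<phi> k \<in> {1..a}" if "k \<in> A" for k
      using m_in[OF that] by (auto simp: \<phi>_def min_def)
    moreover have "\<phi> k = k" if "k \<in> {1..a}" for k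
      using that by (auto simp: \<phi>_def m_def r_def min_def)
    ultimately show ?thesis
      by (intro n_comps_transfer[where \<phi> = \<phi> and \<psi> = id])
        (use invA to_\<phi> in \<open>auto simp: involution_on_def[of _ id] A_def\<close>)
  qed
  also have "n_comps B f r = meander_components xs"
    unfolding meander_components_eq X_def[symmetric]
  proof (rule n_comps_transfer[where \<phi> = "\<lambda>k. k - 2 * a" and \<psi> = "\<lambda>k. k + 2 * a"])
    let ?r = "\<lambda>k. 2 * X + 1 - k"
    show "involution_on {1..2 * X} (mate xs)" "involution_on {1..2 * X} ?r"
      using involution_mate[of xs] involution_reflect[of "2 * X"] by (simp_all add: X_def)
    fix k
    {
      assume k: "k \<in> B"
      show "linked (mate xs) ?r (k - 2 * a) (f k - 2 * a)"
        using linked_step_left[of "mate xs" ?r "k - 2 * a"] by (simp add: fB[OF k])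
      have "r k - 2 * a = ?r (k - 2 * a)" using k by (auto simp: r_def B_def)
      then show "linked (mate xs) ?r (k - 2 * a) (r k - 2 * a)"
        by (simp only: linked_step_right)
    next
      assume k: "k \<in> {1..2 * X}"
      have "mate xs k + 2 * a = f (k + 2 * a)" using fB[of "k + 2 * a"] k by (simp add: B_def)
      then show "linked f r (k + 2 * a) (mate xs k + 2 * a)" by (simp only: linked_step_left)
      have "?r k + 2 * a = r (k + 2 * a)" using k by (auto simp: r_def)
      then show "linked f r (k + 2 * a) (?r k + 2 * a)" by (simp only: linked_step_right)
    }
  qed (use invB in \<open>auto simp: B_def\<close>)
  finally show ?thesis unfolding n_comps_id by simp
qed

text \<open>Lower arcs join the first rainbow to the last \<open>2 * a\<close> points of the last
  one; eliminating both leaves a centred window of \<open>2 * X + 2 * d\<close> points. Since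
  \<open>c = a + d\<close> is congruent to \<open>r = a mod d\<close> modulo \<open>d\<close>, the
  reflection of \<open>j\<close> to \<open>2 * c + 1 - j\<close> becomes that to
  \<open>2 * r + 1 - j\<close> modulo \<open>2 * d\<close>, whose arcs on \<open>1..2 * d\<close>
  form the rainbows \<open>r\<close> and \<open>d - r\<close>.\<close>

lemma meander_components_absorb_first:
  fixes a c :: nat
  defines "d \<equiv> c - a"
  assumes "a < c"
  shows "meander_components (a # xs @ [c]) = meander_components (xs @ [a mod d, d - a mod d])"
proof -
  define X where "X = sum_list xs"
  define r where "r = a mod d"
  have d: "0 < d" "c = a + d" using \<open>a < c\<close> by (auto simp: d_def)
  have r: "r < d" using d by (simp add: r_def)
  define f where "f = mate (a # xs @ [c])"
  define f' where "f' = mate (xs @ [r, d - r])"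
  define g where "g k = 2 * (a + X + c) + 1 - k" for k
  define g' where "g' k = 2 * (X + d) + 1 - k" for k
  define P where "P = {1..2 * (a + X + c)}"
  define P' where "P' = {1..2 * (X + d)}"
  \<comment> \<open>The representative modulo \<open>2 * d\<close> in \<open>1..2 * d\<close>; the
    shift by one is due to numbering points from 1.\<close>
  define \<rho> where "\<rho> j = (j - 1) mod (2 * d) + 1" for j
  \<comment> \<open>The upper arcs of the rainbows \<open>r\<close> and \<open>d - r\<close>, in
    positions counted from the end of \<open>xs\<close>.\<close>
  define \<tau> where "\<tau> j = (if j \<le> 2 * r then 2 * r + 1 - j else 2 * d + 2 * r + 1 - j)" for j
  \<comment> \<open>A point of the first rainbow is first moved along its lower arc to position
    \<open>2 * c + 1 - k\<close> of the last rainbow; positions there are reduced modulo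
    \<open>2 * d\<close>.\<close>
  define \<phi> where "\<phi> k = (if k \<le> 2 * a then 2 * X + \<rho> (2 * c + 1 - k)
    else if k \<le> 2 * a + 2 * X then k - 2 * a else 2 * X + \<rho> (k - 2 * a - 2 * X))" for k

  have \<rho>_range: "1 \<le> \<rho> j" "\<rho> j \<le> 2 * d" for j
    using mod_less_divisor[of "2 * d" "j - 1"] d by (simp_all add: \<rho>_def Suc_le_eq)
  have \<rho>_id: "\<rho> j = j" if "1 \<le> j" "j \<le> 2 * d" for j
    using that by (simp add: \<rho>_def)
  have \<rho>_mult: "\<rho> (j + 2 * d * m) = \<rho> j" if "1 \<le> j" for j m
  proof -
    have "j + 2 * d * m - 1 = (j - 1) + 2 * d * m" using that by simp
    then show ?thesis by (simp only: \<rho>_def mod_mult_self2)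
  qed
  have \<rho>_reflect: "\<rho> (2 * c + 1 - j) = \<tau> (\<rho> j)" if j: "1 \<le> j" "j \<le> 2 * c" for j
  proof -
    define m where "m = (j - 1) div (2 * d)"
    \<comment> \<open>This is \<open>c div d\<close>; the extra 1 comes from
      \<open>c = a + d\<close>.\<close>
    define q where "q = a div d + 1"
    have c: "c = d * q + r" using d by (simp add: q_def r_def algebra_simps)
    have j_eq: "j = 2 * d * m + \<rho> j"
      using j mult_div_mod_eq[of "2 * d" "j - 1"] by (simp add: m_def \<rho>_def)
    show ?thesis
    proof (cases "\<rho> j \<le> 2 * r")
      case True
      have "m \<le> q"
      proof (rule ccontr)
        assume "\<not> m \<le> q"
        then have "d * (q + 1) \<le> d * m" by (intro mult_le_mono2) simp
        then show False using j_eq j c \<rho>_range[of j] r by (simp add: algebra_simps)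
      qed
      then obtain n where "q = m + n" using le_Suc_ex by blast
      then have "2 * c + 1 - j = \<tau> (\<rho> j) + 2 * d * n"
        using j_eq c True by (simp add: \<tau>_def algebra_simps)
      then show ?thesis
        using \<rho>_mult[of "\<tau> (\<rho> j)" n] \<rho>_id[of "\<tau> (\<rho> j)"] True \<rho>_range[of j] r
        by (simp add: \<tau>_def)
    next
      case False
      \<comment> \<open>Here \<open>2 * r + 1 - \<rho> j\<close> would not be positive, so one
        period has to be borrowed and the inequality must be strict.\<close>
      have "m < q"
      proof (rule ccontr)
        assume "\<not> m < q"
        then have "d * q \<le> d * m" by (intro mult_le_mono2) simp
        then show False using j_eq j c False by linarith
      qed
      then obtain n where "q = m + n + 1" using less_imp_Suc_add by fastforce
      then have "2 * c + 1 - j = \<tau> (\<rho> j) + 2 * d * n"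
        using j_eq c False \<rho>_range[of j] by (simp add: \<tau>_def algebra_simps)
      then show ?thesis
        using \<rho>_mult[of "\<tau> (\<rho> j)" n] \<rho>_id[of "\<tau> (\<rho> j)"] False \<rho>_range[of j] r
        by (simp add: \<tau>_def)
    qed
  qed

  have f_left: "f k = 2 * a + 1 - k" if "k \<le> 2 * a" for k
    using that by (simp add: f_def)
  have f_mid: "f (2 * a + k) = 2 * a + mate xs k" if "0 < k" "k \<le> 2 * X" for k
    using that by (simp add: f_def mate_append X_def)
  have f_right: "f (2 * a + 2 * X + j) = 2 * a + 2 * X + (2 * c + 1 - j)"
    if "0 < j" "j \<le> 2 * c" for j
    using that by (simp add: f_def mate_append X_def)
  have f'_left: "f' k = mate xs k" if "0 < k" "k \<le> 2 * X" for k
    using that by (simp add: f'_def mate_append X_def)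
  have f'_right: "f' (2 * X + j) = 2 * X + \<tau> j" if "0 < j" "j \<le> 2 * d" for j
    using that r by (auto simp: f'_def mate_append X_def \<tau>_def)
  have mate_xs: "0 < mate xs k" "mate xs k \<le> 2 * X" if "0 < k" "k \<le> 2 * X" for k
    using that mate_bounds[of k xs] by (auto simp: X_def)

  \<comment> \<open>On the last rainbow, \<open>f \<circ> g \<circ> f \<circ> g\<close> is the translation by \<open>- 2 * d\<close>.\<close>
  have to_\<rho>: "linked f g (2 * a + 2 * X + i) (2 * a + 2 * X + \<rho> i)" if "0 < i" "i \<le> 2 * c" for i
    using that
  proof (induction i rule: less_induct)
    case (less i)
    show ?case
    proof (cases "i \<le> 2 * d")
      case True
      then show ?thesis using less.prems by (simp add: \<rho>_id)
    next
      case False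
      have 1: "g (2 * a + 2 * X + i) = 2 * c + 1 - i" using less.prems by (simp add: g_def)
      have 2: "f (2 * c + 1 - i) = i - 2 * d" using less.prems False d by (simp add: f_left)
      have 3: "g (i - 2 * d) = 2 * a + 2 * X + (2 * c + 1 - (i - 2 * d))"
        using less.prems False by (simp add: g_def)
      have 4: "f (2 * a + 2 * X + (2 * c + 1 - (i - 2 * d))) = 2 * a + 2 * X + (i - 2 * d)"
        using less.prems False d by (subst f_right) auto
      have "linked f g (2 * a + 2 * X + i) (2 * a + 2 * X + (i - 2 * d))"
        using linked_left[OF linked_right[OF linked_left[OF linked_right[OF linked_refl]]],
            of f g "2 * a + 2 * X + i"]
        by (simp only: 1 2 3 4)
      also have "linked f g \<dots> (2 * a + 2 * X + \<rho> (i - 2 * d))"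
        using less.prems False d by (intro less.IH) auto
      also have "\<rho> (i - 2 * d) = \<rho> i"
        using \<rho>_mult[of "i - 2 * d" 1] False by simp
      finally show ?thesis .
    qed
  qed

  have blocks: "k \<le> 2 * a \<or> (\<exists>i. 0 < i \<and> i \<le> 2 * X \<and> k = 2 * a + i) \<or>
      (\<exists>j. 0 < j \<and> j \<le> 2 * c \<and> k = 2 * a + 2 * X + j)" if "k \<in> P" for k
  proof -
    consider "k \<le> 2 * a" | "2 * a < k" "k \<le> 2 * a + 2 * X" | "2 * a + 2 * X < k" by linarith
    then show ?thesis
    proof cases
      case 2
      then show ?thesis by (intro disjI2 disjI1 exI[of _ "k - 2 * a"]) auto
    next
      case 3
      then show ?thesis using that
        by (intro disjI2 exI[of _ "k - 2 * a - 2 * X"]) (auto simp: P_def)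
    qed simp
  qed
  have \<phi>_left: "\<phi> k = 2 * X + \<rho> (2 * c + 1 - k)" if "k \<le> 2 * a" for k
    using that by (simp add: \<phi>_def)
  have \<phi>_mid: "\<phi> (2 * a + k) = k" if "0 < k" "k \<le> 2 * X" for k
    using that by (simp add: \<phi>_def)
  have \<phi>_right: "\<phi> (2 * a + 2 * X + j) = 2 * X + \<rho> j" if "0 < j" for j
    using that by (simp add: \<phi>_def)
  have \<phi>_shift: "\<phi> (2 * a + k) = k" if "k \<in> P'" for k
    using that by (auto simp: \<phi>_def P'_def \<rho>_id)
  have \<phi>_f: "\<phi> (f k) = f' (\<phi> k)" if "k \<in> P" for k
    using blocks[OF that]
  proof (elim disjE exE conjE)
    assume k: "k \<le> 2 * a"
    have "0 < k" using that by (simp add: P_def)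
    \<comment> \<open>In positions of the last rainbow, \<open>k\<close> reads as
      \<open>2 * c + 1 - k\<close> and its upper neighbour as \<open>k + 2 * d\<close>. Reflecting
      the former gives \<open>k\<close>, which is congruent to the latter.\<close>
    have "\<phi> (f k) = 2 * X + \<rho> (2 * c + 1 - (2 * a + 1 - k))"
      using k \<open>0 < k\<close> by (simp add: f_left \<phi>_left)
    also have "2 * c + 1 - (2 * a + 1 - k) = k + 2 * d * 1" using k d by simp
    also have "\<rho> \<dots> = \<rho> k" using \<open>0 < k\<close> by (intro \<rho>_mult) simp
    also have "\<dots> = \<tau> (\<rho> (2 * c + 1 - k))"
      using \<rho>_reflect[of "2 * c + 1 - k"] k \<open>0 < k\<close> d by simp
    also have "2 * X + \<dots> = f' (\<phi> k)"
      using k \<rho>_range[of "2 * c + 1 - k"] by (simp add: \<phi>_left f'_right)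
    finally show ?thesis .
  next
    fix i assume "0 < i" "i \<le> 2 * X" "k = 2 * a + i"
    then show ?thesis using mate_xs[of i] by (simp add: f_mid \<phi>_mid f'_left)
  next
    fix j assume "0 < j" "j \<le> 2 * c" "k = 2 * a + 2 * X + j"
    then show ?thesis
      using f_right[of j] \<phi>_right[of "2 * c + 1 - j"] \<rho>_reflect[of j] \<rho>_range[of j]
      by (simp add: \<phi>_right f'_right)
  qed
  \<comment> \<open>The window is centred, so lower arcs inside it become the new lower arcs. Those
    between the first rainbow and the end of the last are contracted, because \<open>\<phi>\<close>
    follows them.\<close>
  have \<phi>_g: "\<phi> (g k) = g' (\<phi> k) \<or> \<phi> (g k) = \<phi> k" if "k \<in> P" for k
  proof -
    consider "k \<le> 2 * a" | "2 * a < k" "k \<le> 2 * a + 2 * X + 2 * d" | "2 * a + 2 * X + 2 * d < k"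
      by linarith
    then show ?thesis
    proof cases
      case 1
      then have gk: "g k = 2 * a + 2 * X + (2 * c + 1 - k)" using d by (simp add: g_def)
      have "\<phi> (g k) = 2 * X + \<rho> (2 * c + 1 - k)"
        unfolding gk using 1 d by (intro \<phi>_right) simp
      then show ?thesis using 1 by (simp add: \<phi>_left)
    next
      case 2
      then have "k - 2 * a \<in> P'" "g k - 2 * a \<in> P'" "2 * a < g k"
        using d by (auto simp: P'_def g_def)
      then have "\<phi> k = k - 2 * a" "\<phi> (g k) = g k - 2 * a"
        using 2 \<phi>_shift[of "k - 2 * a"] \<phi>_shift[of "g k - 2 * a"] by simp_all
      then show ?thesis using 2 d by (simp add: g_def g'_def ac_simps)
    next
      case 3
      then have "\<phi> k = 2 * X + \<rho> (k - 2 * a - 2 * X)" by (simp add: \<phi>_def)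
      moreover have "g k \<le> 2 * a" "2 * c + 1 - g k = k - 2 * a - 2 * X"
        using 3 d that by (auto simp: g_def P_def)
      ultimately show ?thesis by (simp add: \<phi>_left)
    qed
  qed

  have "n_comps P f g = n_comps P' f' g'"
  proof (rule n_comps_transfer[where \<phi> = \<phi> and \<psi> = "\<lambda>k. 2 * a + k"])
    show "involution_on P f" "involution_on P g" "involution_on P' f'" "involution_on P' g'"
      using involution_mate[of "a # xs @ [c]"] involution_mate[of "xs @ [r, d - r]"]
        involution_reflect[of "2 * (a + X + c)"] involution_reflect[of "2 * (X + d)"] r
      by (simp_all add: P_def P'_def f_def f'_def g_def[abs_def] g'_def[abs_def] X_def add.assoc)
    fix k
    {
      assume k: "k \<in> P"
      show "\<phi> k \<in> P'"
        using blocks[OF k] \<rho>_range by (auto simp: \<phi>_left \<phi>_mid \<phi>_right P'_def trans_le_add2)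
      show "linked f' g' (\<phi> k) (\<phi> (f k))" using \<phi>_f[OF k] linked_step_left by metis
      show "linked f' g' (\<phi> k) (\<phi> (g k))" using \<phi>_g[OF k] linked_step_right linked_refl by metis
      show "linked f g k (2 * a + \<phi> k)"
        using blocks[OF k]
      proof (elim disjE exE conjE)
        assume "k \<le> 2 * a"
        then have "g k = 2 * a + 2 * X + (2 * c + 1 - k)" "0 < 2 * c + 1 - k" "2 * c + 1 - k \<le> 2 * c"
          using d k by (auto simp: g_def P_def)
        then show ?thesis
          using linked_step_right[of f g k] to_\<rho>[of "2 * c + 1 - k"] \<open>k \<le> 2 * a\<close> linked_trans
          by (metis \<phi>_left add.assoc)
      next
        fix j assume "0 < j" "j \<le> 2 * c" "k = 2 * a + 2 * X + j"
        then show ?thesis using to_\<rho>[of j] \<phi>_right[of j] by (simp add: add.assoc)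
      qed (simp add: \<phi>_mid)
    next
      assume k: "k \<in> P'"
      show "2 * a + k \<in> P" using k d by (simp add: P_def P'_def)
      have "g (2 * a + k) = 2 * a + g' k" using k d by (auto simp: g_def g'_def P'_def)
      then show "linked f g (2 * a + k) (2 * a + g' k)" using linked_step_right by metis
      show "\<phi> (2 * a + k) = k" by (rule \<phi>_shift[OF k])
      show "linked f g (2 * a + k) (2 * a + f' k)"
      proof (cases "k \<le> 2 * X")
        case True
        then have "f (2 * a + k) = 2 * a + f' k" using k by (simp add: f_mid f'_left P'_def)
        then show ?thesis using linked_step_left by metis
      next
        case False
        then obtain j where j: "k = 2 * X + j" "0 < j" 
          using less_imp_add_positive[of "2 * X" k] by auto
        then have "j \<le> 2 * d" using k by (simp add: P'_def)
        \<comment> \<open>This arc may leave the window; \<open>to_\<rho>\<close> leads back into it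
          within the same component.\<close>
        have "linked f g (2 * a + k) (2 * a + 2 * X + (2 * c + 1 - j))"
          using linked_step_left[of f g "2 * a + k"] f_right[of j] j \<open>j \<le> 2 * d\<close> d
          by (simp add: add.assoc)
        also have "linked f g \<dots> (2 * a + 2 * X + \<rho> (2 * c + 1 - j))"
          using j \<open>j \<le> 2 * d\<close> d by (intro to_\<rho>) auto
        also have "\<rho> (2 * c + 1 - j) = \<tau> j"
          using \<rho>_reflect[of j] \<rho>_id[of j] j \<open>j \<le> 2 * d\<close> d by simp
        finally show ?thesis using j \<open>j \<le> 2 * d\<close> by (simp add: f'_right add.assoc)
      qed
    }
  qed
  then show ?thesis
    using r
    by (simp add: meander_components_eq P_def P'_def f_def f'_def g_def[abs_def] g'_def[abs_def]
        X_def r_def add.assoc)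
qed

section \<open>Rotations of the tuple\<close>

lemma meander_components_rotate:
  assumes "a < c" "2 * a \<le> c"
  shows "meander_components (a # xs @ [c]) = meander_components (xs @ [a, c - 2 * a])"
proof (cases "c = 2 * a")
  \<comment> \<open>Here \<open>c - a = a\<close>, so the remainder is 0 and the pair
    \<open>0, a\<close> must be exchanged for \<open>a, 0\<close>, which goes through deletion of
    zeros.\<close>
  case True
  then have "meander_components (a # xs @ [c]) = meander_components (xs @ [0, a])"
    using meander_components_absorb_first[OF \<open>a < c\<close>, of xs] by simp
  then show ?thesis
    using assms True meander_components_remove_zeros[of "xs @ [0, a]"]
      meander_components_remove_zeros[of "xs @ [a, 0]"] by simp
next
  case False
  then have "a mod (c - a) = a" "c - a - a = c - 2 * a" using assms by auto
  then show ?thesis using meander_components_absorb_first[OF \<open>a < c\<close>, of xs] by simp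
qed

text \<open>Generalising over \<open>zs\<close> lets the entries already passed accumulate there
  during the induction.\<close>

lemma meander_components_rotate_list:
  "\<lbrakk>\<forall>y\<in>set ys. 0 < y; 2 * sum_list ys \<le> c\<rbrakk> \<Longrightarrow>
    meander_components (ys @ zs @ [c]) = meander_components (zs @ ys @ [c - 2 * sum_list ys])"
proof (induction ys arbitrary: zs c)
  case (Cons y ys)
  have "meander_components ((y # ys) @ zs @ [c]) = meander_components (ys @ (zs @ [y]) @ [c - 2 * y])"
    using Cons.prems meander_components_rotate[of y c "ys @ zs"] by simp
  also have "\<dots> = meander_components ((zs @ [y]) @ ys @ [c - 2 * y - 2 * sum_list ys])"
    using Cons.prems by (intro Cons.IH) auto
  finally show ?case by (simp add: diff_diff_left)
qed simp

text \<open>A full round through \<open>ys\<close> restores their order and takes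
  \<open>2 * sum_list ys\<close> from the last entry; rounds are repeated until less than that is
  left.\<close>

lemma meander_components_last_mod:
  assumes "\<forall>y\<in>set ys. 0 < y" "ys \<noteq> []"
  shows "meander_components (ys @ [c]) = meander_components (ys @ [c mod (2 * sum_list ys)])"
proof (induction c rule: less_induct)
  case (less c)
  have pos: "0 < sum_list ys" using assms by (cases ys) auto
  show ?case
  proof (cases "2 * sum_list ys \<le> c")
    case True
    then show ?thesis
      using meander_components_rotate_list[OF assms(1), of c "[]"] less.IH[of "c - 2 * sum_list ys"]
        pos by (simp add: le_mod_geq)
  qed simp
qed

lemma meander_components_recursion:
  assumes pos: "\<forall>x \<in> set (a # xs @ [c]). x > 0" and \<alpha>: "\<alpha> = sum_list (a # xs @ [c])"
  shows "meander_components (a # xs @ [c]) =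
         (if a > c then
            meander_components (c # rev xs @ [a])
          else if a = c then
            meander_components xs + a
          else if a < c \<and> c < 2 * a then
            meander_components
              (remove_zeros (a mod (c - a) # xs @ [c - a + a mod (c - a)]))
          else if 2 * a = c then
            meander_components (xs @ [a])
          else if 2 * a < c \<and> real c < 2 / 3 * real \<alpha> then
            meander_components (xs @ [a, c - 2 * a])
          else if 2 * (\<alpha> - c) dvd c then
            meander_components (a # xs)
          else
            meander_components (a # xs @ [c mod (2 * (\<alpha> - c))]))"
proof -
  let ?r = "a mod (c - a)"
  have zero: "meander_components (ys @ [0]) = meander_components ys" for ys
    using meander_components_remove_zeros[of "ys @ [0]"] meander_components_remove_zeros[of ys] by simp
  have flip: "meander_components (a # xs @ [c]) = meander_components (c # rev xs @ [a])"
    using meander_components_rev[of "a # xs @ [c]"] by simp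
  have equal: "meander_components (a # xs @ [c]) = meander_components xs + a" if "a = c"
    using that meander_components_equal_ends by simp
  have short: "meander_components (a # xs @ [c]) =
      meander_components (remove_zeros (?r # xs @ [c - a + ?r]))" if "a < c"
  proof -
    have r: "?r < c - a" using that by simp
    \<comment> \<open>The ends of this tuple again differ by \<open>c - a\<close>, and
      \<open>?r\<close> is its own remainder, so absorbing its first entry gives the same tuple as
      for \<open>(a, xs, c)\<close>.\<close>
    have "meander_components (?r # xs @ [c - a + ?r]) = meander_components (xs @ [?r, c - a - ?r])"
      using meander_components_absorb_first[of ?r "c - a + ?r" xs] r by simp
    then show ?thesis
      using meander_components_absorb_first[OF that, of xs]
        meander_components_remove_zeros[of "?r # xs @ [c - a + ?r]"] by simp
  qed
  have double: "meander_components (a # xs @ [c]) = meander_components (xs @ [a])" if "2 * a = c"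
    using meander_components_rotate[of a c xs] zero[of "xs @ [a]"] pos that by auto
  have medium: "meander_components (a # xs @ [c]) = meander_components (xs @ [a, c - 2 * a])"
    if "2 * a < c"
    using that meander_components_rotate by simp
  have last: "meander_components (a # xs @ [c]) =
      meander_components (a # xs @ [c mod (2 * (\<alpha> - c))])"
    using meander_components_last_mod[of "a # xs" c] pos \<alpha> by simp
  have divides: "meander_components (a # xs @ [c]) = meander_components (a # xs)"
    if "2 * (\<alpha> - c) dvd c"
    using last that zero[of "a # xs"] by simp
  consider "c < a" | "a = c" | "a < c" "c < 2 * a" | "c = 2 * a" | "2 * a < c" by linarith
  then show ?thesis
  proof cases
    case 1
    then show ?thesis using flip by simp
  next
    case 2
    then show ?thesis using equal by simp
  next
    case 3
    then show ?thesis using short by simp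
  next
    case 4
    then show ?thesis using double pos by simp
  next
    case 5
    show ?thesis
    proof (cases "real c < 2 / 3 * real \<alpha>")
      case True
      then show ?thesis using medium 5 by simp
    next
      case False
      then show ?thesis using last divides 5 by (cases "2 * (\<alpha> - c) dvd c") auto
    qed
  qed
qed

section \<open>The running time\<close>

definition bits :: "nat \<Rightarrow> nat" where
  "bits x = nat \<lceil>log 2 (real x + 1)\<rceil>"

text \<open>Removes the logarithm: bit lengths are compared through powers of two from here
  on.\<close>

lemma bits_le_iff: "bits x \<le> k \<longleftrightarrow> x < 2 ^ k"
proof -
  have "bits x \<le> k \<longleftrightarrow> log 2 (real x + 1) \<le> real k"
    by (simp add: bits_def nat_le_iff ceiling_le_iff)
  also have "\<dots> \<longleftrightarrow> real x + 1 \<le> 2 ^ k"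
    by (simp add: log_le_iff powr_realpow)
  also have "\<dots> \<longleftrightarrow> real (x + 1) \<le> real (2 ^ k)"
    by (simp add: add.commute)
  also have "\<dots> \<longleftrightarrow> x < 2 ^ k"
    unfolding of_nat_le_iff by linarith
  finally show ?thesis .
qed

lemma bits_mono: "x \<le> y \<Longrightarrow> bits x \<le> bits y"
  using bits_le_iff[of y "bits y"] bits_le_iff[of x "bits y"] by simp

lemma bits_pos: "0 < x \<Longrightarrow> 0 < bits x"
  using bits_le_iff[of x 0] by simp

lemma bits_half:
  assumes "2 * y \<le> x" "0 < x"
  shows "bits y < bits x"
proof -
  obtain k where k: "bits x = Suc k" using bits_pos[OF assms(2)] gr0_implies_Suc by blast
  then have "x < 2 ^ Suc k" using bits_le_iff[of x "Suc k"] by simp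
  then have "y < 2 ^ k" using assms(1) by simp
  then show ?thesis using bits_le_iff[of y k] k by simp
qed

lemma input_bits_simps [simp]:
  "input_bits [] = 0" "input_bits (x # xs) = bits x + input_bits xs"
  "input_bits (xs @ ys) = input_bits xs + input_bits ys" "input_bits (rev xs) = input_bits xs"
  by (simp_all add: input_bits_def bits_def flip: rev_map)

text \<open>The number of successive rotations in which the last entry \<open>c\<close> passes entries at the front.\<close>

fun hops :: "nat list \<Rightarrow> nat \<Rightarrow> nat" where
  "hops [] c = 0"
| "hops (a # xs) c = (if 2 * a < c then Suc (hops xs (c - 2 * a)) else 0)"

lemma hops_le: "hops xs c \<le> length xs"
  by (induction xs arbitrary: c) auto

text \<open>By the end of \<open>xs\<close> nothing of \<open>c\<close> is left, so entries behind
  \<open>xs\<close> are never passed.\<close>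

lemma hops_append: "c \<le> 2 * sum_list xs \<Longrightarrow> hops (xs @ ys) c = hops xs c"
  by (induction xs arbitrary: c) (auto, cases ys, auto)

text \<open>This is \<open>\<Psi>\<close>, written without subtraction.\<close>

definition main_weight :: "nat list \<Rightarrow> nat" where
  "main_weight as = input_bits (butlast as) + input_bits as"

text \<open>Hops count twice so that a rotation also pays for the flip that it may make necessary.\<close>

definition weight :: "nat \<Rightarrow> nat list \<Rightarrow> nat" where
  "weight N as = 2 * N * main_weight as +
    (if as = [] then 0 else 2 * hops (butlast as) (last as) + of_bool (last as < hd as))"

text \<open>Fewer than \<open>N\<close> entries precede the last one, so the secondary term stays
  below \<open>2 * N\<close>, and a unit drop of \<open>main_weight\<close> outweighs any change in
  it.\<close>

lemma weight_less:
  assumes "length as \<le> N" "0 < N"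
  shows "weight N as < 2 * N * (main_weight as + 1)"
proof (cases "as = []")
  case False
  then have "2 * hops (butlast as) (last as) + 1 < 2 * N"
    using hops_le[of "butlast as" "last as"] assms by (cases as) auto
  then show ?thesis by (simp add: weight_def algebra_simps)
qed (use assms in \<open>simp add: weight_def\<close>)

lemma weight_decreases:
  assumes "main_weight as' < main_weight as" "length as' \<le> N" "0 < N"
  shows "weight N as' < weight N as"
proof -
  have "weight N as' < 2 * N * (main_weight as' + 1)" by (rule weight_less) fact+
  also have "\<dots> \<le> 2 * N * main_weight as" using assms(1) by (intro mult_le_mono2) simp
  also have "\<dots> \<le> weight N as" by (simp add: weight_def)
  finally show ?thesis .
qed

lemma main_weight_snoc [simp]: "main_weight (xs @ [c]) = 2 * input_bits xs + bits c"
  by (simp add: main_weight_def)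

lemma main_weight_Cons_snoc [simp]: "main_weight (a # xs @ [c]) = 2 * bits a + 2 * input_bits xs + bits c"
  using main_weight_snoc[of "a # xs" c] by simp

lemma main_weight_le: "main_weight as \<le> 2 * input_bits as"
  by (cases as rule: rev_cases) (auto simp: main_weight_def)

text \<open>If \<open>2 * c < a\<close>, the longer number moves to the position whose bits count
  only once. Otherwise neither order permits a rotation, so both hop counts vanish and the flip
  indicator falls from 1 to 0.\<close>

lemma weight_flip:
  assumes "c < a" "length xs + 2 \<le> N" 
  shows "weight N (c # rev xs @ [a]) < weight N (a # xs @ [c])"
proof (cases "2 * c < a")
  case True
  then show ?thesis using bits_half[of c a] assms by (intro weight_decreases) auto
next
  case False
  have "main_weight (c # rev xs @ [a]) \<le> main_weight (a # xs @ [c])"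
    using bits_mono[of c a] assms by simp
  then have "2 * N * main_weight (c # rev xs @ [a]) \<le> 2 * N * main_weight (a # xs @ [c])"
    by (rule mult_le_mono2)
  moreover have "weight N (c # rev xs @ [a]) = 2 * N * main_weight (c # rev xs @ [a])"
    "weight N (a # xs @ [c]) = 2 * N * main_weight (a # xs @ [c]) + 1"
    unfolding weight_def using False assms by simp_all
  ultimately show ?thesis by linarith
qed

text \<open>One hop, worth 2, is used up, while the flip indicator grows by at most 1.\<close>

lemma weight_rotate:
  assumes "2 * a < c" "3 * c < 2 * sum_list (a # xs @ [c])"
  shows "weight N (xs @ [a, c - 2 * a]) < weight N (a # xs @ [c])"
proof -
  define c' where "c' = c - 2 * a"
  have "main_weight (xs @ [a, c']) \<le> main_weight (a # xs @ [c])"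
    using main_weight_snoc[of "xs @ [a]"] bits_mono[of c' c] by (simp add: c'_def)
  then have "2 * N * main_weight (xs @ [a, c']) \<le> 2 * N * main_weight (a # xs @ [c])"
    by (rule mult_le_mono2)
  \<comment> \<open>The size bound gives \<open>c' < 2 * sum_list xs\<close>, so the entry
    \<open>a\<close>, now behind \<open>xs\<close>, is out of reach.\<close>
  moreover have "hops (xs @ [a]) c' = hops xs c'"
    using assms by (intro hops_append) (auto simp: c'_def)
  then have "weight N (xs @ [a, c']) \<le> 2 * N * main_weight (xs @ [a, c']) + 2 * hops xs c' + 1"
    by (simp add: weight_def butlast_append)
  moreover have "weight N (a # xs @ [c]) = 2 * N * main_weight (a # xs @ [c]) + 2 * hops xs c' + 2"
    unfolding weight_def using assms by (simp add: c'_def)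
  ultimately show ?thesis unfolding c'_def[symmetric] by linarith
qed

section \<open>Cost of one step of the iteration\<close>

lemmas counting_simps = counted_bind_def counted_return_def op_less_def op_eq_def op_add_def
  op_sub_def op_mod_def Let_def

context
  fixes a c s z t :: nat and xs :: "nat list"
begin

text \<open>The constants in this group of lemmas count the primitives executed on the branch apart
  from the recursive call. The largest is 14, for the final division step with nonzero
  remainder.\<close>

lemma iterate_flip:
  assumes "c < a" "meander_iterate (c # rev xs @ [a]) s = Some (z, t)"
  shows "meander_iterate (a # xs @ [c]) s = Some (z, t + 1)"
  using assms by (subst meander_iterate.simps) (simp add: counting_simps)

lemma iterate_equal:
  assumes "meander_iterate xs (s - (a + a)) = Some (z, t)"
  shows "meander_iterate (a # xs @ [a]) s = Some (z + a, t + 5)"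
  using assms by (subst meander_iterate.simps) (simp add: counting_simps)

lemma iterate_short:
  fixes r defines "r \<equiv> a mod (c - a)"
  assumes "a < c" "c < 2 * a"
    and "meander_iterate (if r = 0 then xs @ [c - a + r] else r # xs @ [c - a + r])
      (s - a - c + r + (c - a + r)) = Some (z, t)"
  shows "meander_iterate (a # xs @ [c]) s = Some (z, t + 12)"
  using assms(2-) unfolding r_def
  by (subst meander_iterate.simps) (auto simp add: counting_simps mult_2)

lemma iterate_double:
  assumes "0 < a" "c = 2 * a" "meander_iterate (xs @ [a]) (s - c) = Some (z, t)"
  shows "meander_iterate (a # xs @ [c]) s = Some (z, t + 6)"
  using assms by (subst meander_iterate.simps) (simp add: counting_simps)

lemma iterate_medium:
  assumes "2 * a < c" "3 * c < 2 * s"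
    and "meander_iterate (xs @ [a, c - 2 * a]) (s - 2 * a) = Some (z, t)"
  shows "meander_iterate (a # xs @ [c]) s = Some (z, t + 11)"
proof -
  have conds: "(c < a) = False" "(a = c) = False" "(c < 2 * a) = False" "(2 * a = c) = False"
    "c + c + c < s + s" "a + a = 2 * a" using assms by auto
  show ?thesis
    by (subst meander_iterate.simps)
      (simp only: counting_simps list.case append_is_Nil_conv list.distinct simp_thms if_False if_True
        butlast_snoc last_snoc Option.bind_lunit fst_conv snd_conv conds assms(3), simp)
qed

lemma iterate_long:
  fixes r defines "r \<equiv> c mod (2 * (s - c))"
  assumes "2 * a < c" "2 * s \<le> 3 * c"
    and "meander_iterate (if r = 0 then a # xs else a # xs @ [r]) (s - c + r) = Some (z, t)"
  shows "\<exists>t' \<le> t + 14. meander_iterate (a # xs @ [c]) s = Some (z, t')"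
proof -
  have conds: "(c < a) = False" "(a = c) = False" "(c < 2 * a) = False" "(2 * a = c) = False"
    "(c + c + c < s + s) = False" "s - c + (s - c) = 2 * (s - c)" "a + a = 2 * a"
    using assms(2,3) by auto
  have "meander_iterate (a # xs @ [c]) s = Some (z, if r = 0 then t + 13 else t + 14)"
    using assms(4) unfolding r_def
    by (subst meander_iterate.simps)
      (simp only: counting_simps list.case append_is_Nil_conv list.distinct simp_thms if_False if_True
        butlast_snoc last_snoc Option.bind_lunit fst_conv snd_conv conds, simp split: if_splits)
  then show ?thesis by (simp split: if_splits)
qed

end

text \<open>Together with \<open>n mod d < d\<close> this gives
  \<open>2 * (n mod d) \<le> n\<close>, the halving behind both division steps.\<close>

lemma add_mod_le:
  fixes d n :: nat
  assumes "d \<le> n"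
  shows "d + n mod d \<le> n"
proof -
  have "n mod d = (n - d) mod d" by (rule le_mod_geq) fact
  also have "\<dots> \<le> n - d" by (rule mod_less_eq_dividend)
  finally show ?thesis using assms by simp
qed

text \<open>Every step executes at most 14 primitives and lowers the weight by at least 1, so the
  weight pays for the whole run. \<open>N\<close> stays fixed while tuples get shorter, which keeps
  their weights comparable.\<close>

lemma meander_iterate_correct:
  assumes "\<forall>x\<in>set as. 0 < x" "length as \<le> N"
  shows "\<exists>t. meander_iterate as (sum_list as) = Some (meander_components as, t) \<and>
    t \<le> 14 * weight N as"
  using assms
proof (induction "weight N as" arbitrary: as rule: less_induct)
  case less
  have IH: "\<exists>t. meander_iterate as' s' = Some (meander_components as', t) \<and> t + 14 \<le> 14 * weight N as"
    if "weight N as' < weight N as" "\<forall>x\<in>set as'. 0 < x" "length as' \<le> N" "s' = sum_list as'" for as' s'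
    using less.hyps[OF that(1-3)] that by fastforce
  consider "as = []" | a where "as = [a]" | a xs c where "as = a # xs @ [c]"
    by (metis neq_Nil_conv rev_exhaust)
  then show ?case
  proof cases
    case 1
    then show ?thesis
      by (subst meander_iterate.simps) (simp add: counting_simps meander_components_Nil)
  next
    case (2 a)
    then show ?thesis
      by (subst meander_iterate.simps) (simp add: counting_simps meander_components_single)
  next
    case (3 a xs c)
    note as_eq = 3
    define s where "s = sum_list as"
    have s: "s = a + sum_list xs + c" by (simp add: s_def as_eq)
    have pos: "0 < a" "0 < c" "\<forall>x\<in>set xs. 0 < x" using less.prems as_eq by auto
    have len: "length xs + 2 \<le> N" using less.prems as_eq by simp
    have ba: "0 < bits a" using bits_pos pos by blast
    have rec: "meander_components as = (if a > c then
            meander_components (c # rev xs @ [a])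
          else if a = c then
            meander_components xs + a
          else if a < c \<and> c < 2 * a then
            meander_components
              (remove_zeros (a mod (c - a) # xs @ [c - a + a mod (c - a)]))
          else if 2 * a = c then
            meander_components (xs @ [a])
          else if 2 * a < c \<and> real c < 2 / 3 * real s then
            meander_components (xs @ [a, c - 2 * a])
          else if 2 * (s - c) dvd c then
            meander_components (a # xs)
          else
            meander_components (a # xs @ [c mod (2 * (s - c))]))"
      unfolding as_eq using less.prems(1) as_eq by (intro meander_components_recursion) (auto simp: s)
    consider "c < a" | "a = c" | "a < c" "c < 2 * a" | "c = 2 * a"
      | "2 * a < c" "3 * c < 2 * s" | "2 * a < c" "2 * s \<le> 3 * c" by linarith
    then have "\<exists>t. meander_iterate as s = Some (meander_components as, t) \<and> t \<le> 14 * weight N as"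
    proof cases
      case 1
      have "\<exists>t. meander_iterate (c # rev xs @ [a]) s =
          Some (meander_components (c # rev xs @ [a]), t) \<and> t + 14 \<le> 14 * weight N as"
        using weight_flip[OF 1 len] pos len s unfolding as_eq [symmetric] by (intro IH) auto
      then show ?thesis using iterate_flip[OF 1] rec 1 unfolding as_eq by fastforce
    next
      case 2
      have "weight N xs < weight N as"
        using main_weight_le[of xs] ba len 2 by (intro weight_decreases) (auto simp: as_eq)
      then have "\<exists>t. meander_iterate xs (s - (a + a)) =
          Some (meander_components xs, t) \<and> t + 14 \<le> 14 * weight N as"
        using pos len s 2 by (intro IH) auto
      then show ?thesis using iterate_equal rec 2 unfolding as_eq by fastforce
    next
      case 3
      define r where "r = a mod (c - a)"
      let ?as' = "if r = 0 then xs @ [c - a + r] else r # xs @ [c - a + r]"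
      have sum_le: "c - a + r \<le> a"
        unfolding r_def using 3 by (intro add_mod_le) simp
      moreover have "r < c - a" using 3 by (simp add: r_def)
      \<comment> \<open>The first entry, counted twice, loses a bit or disappears; the new last
        entry is at most \<open>a\<close> and hence no longer than \<open>c\<close>.\<close>
      ultimately have "2 * r \<le> a" by simp
      moreover have "bits (c - a + r) \<le> bits c"
        using sum_le 3 by (intro bits_mono) simp
      ultimately have "weight N ?as' < weight N as"
        using bits_half[of r a] pos len by (intro weight_decreases) (auto simp: as_eq)
      then have "\<exists>t. meander_iterate ?as' (s - a - c + r + (c - a + r)) =
          Some (meander_components ?as', t) \<and> t + 14 \<le> 14 * weight N as"
        using pos len s 3 by (intro IH) auto
      moreover have "meander_components as = meander_components ?as'"
      proof -
        have "remove_zeros (r # xs @ [c - a + r]) = ?as'" using pos 3 by simp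
        moreover have "meander_components as = meander_components (remove_zeros (r # xs @ [c - a + r]))"
          unfolding rec r_def using 3 by simp
        ultimately show ?thesis by (simp only:)
      qed
      ultimately show ?thesis using iterate_short[OF 3] unfolding as_eq r_def by fastforce
    next
      case 4
      have "weight N (xs @ [a]) < weight N as"
        using bits_pos[OF pos(2)] ba len by (intro weight_decreases) (auto simp: as_eq)
      then have "\<exists>t. meander_iterate (xs @ [a]) (s - c) =
          Some (meander_components (xs @ [a]), t) \<and> t + 14 \<le> 14 * weight N as"
        using pos len s 4 by (intro IH) auto
      then show ?thesis using iterate_double[OF pos(1) 4] rec 4 pos unfolding as_eq by fastforce
    next
      case 5
      have "weight N (xs @ [a, c - 2 * a]) < weight N as"
        unfolding as_eq using 5 s by (intro weight_rotate) auto
      then have "\<exists>t. meander_iterate (xs @ [a, c - 2 * a]) (s - 2 * a) =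
          Some (meander_components (xs @ [a, c - 2 * a]), t) \<and> t + 14 \<le> 14 * weight N as"
        using pos len s 5 by (intro IH) auto
      moreover have "real c < 2 / 3 * real s" using 5(2) by linarith
      ultimately show ?thesis using iterate_medium[OF 5] rec 5 unfolding as_eq by fastforce
    next
      case 6
      define r where "r = c mod (2 * (s - c))"
      let ?as' = "if r = 0 then a # xs else a # xs @ [r]"
      \<comment> \<open>The case condition says that the divisor \<open>2 * (s - c)\<close> is at
        most \<open>c\<close>, so the remainder is at most half of \<open>c\<close>.\<close>
      have sc: "0 < s - c" "2 * (s - c) \<le> c" using 6 s pos by auto
      have "bits r < bits c"
      proof (rule bits_half)
        have "2 * (s - c) + r \<le> c"
          unfolding r_def using sc(2) by (rule add_mod_le)
        moreover have "r < 2 * (s - c)" using sc by (simp add: r_def)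
        ultimately show "2 * r \<le> c" by simp
      qed fact
      \<comment> \<open>If the remainder vanishes, an old entry becomes the last one; even with all
        remaining bits counted twice, the bits of \<open>c\<close> are gained.\<close>
      moreover have "main_weight (a # xs) \<le> 2 * input_bits (a # xs)" by (rule main_weight_le)
      ultimately have "weight N ?as' < weight N as"
        using len bits_pos[OF pos(2)] by (intro weight_decreases) (auto simp: as_eq)
      then have "\<exists>t. meander_iterate ?as' (s - c + r) =
          Some (meander_components ?as', t) \<and> t + 14 \<le> 14 * weight N as"
        using pos len s by (intro IH) auto
      moreover have "meander_components as = meander_components ?as'"
      proof -
        have "\<not> real c < 2 / 3 * real s" using 6(2) by linarith
        then show ?thesis using rec 6 by (auto simp: r_def dvd_eq_mod_eq_0)
      qed
      ultimately show ?thesis using iterate_long[OF 6] unfolding as_eq r_def by fastforce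
    qed
    then show ?thesis by (simp add: s_def)
  qed
qed

lemma counted_sum_eq: "counted_sum xs = Some (sum_list xs, length xs)"
  by (induction xs) (auto simp: counting_simps)

text \<open>Serves to absorb the additions for the initial sum into the final bound.\<close>

lemma length_le_input_bits: "\<forall>x\<in>set as. 0 < x \<Longrightarrow> length as \<le> input_bits as"
proof (induction as)
  case (Cons a as)
  then show ?case using bits_pos[of a] by simp
qed simp

lemma meander_algorithm_correct:
  assumes pos: "\<forall>x\<in>set as. 0 < x" and "as \<noteq> []"
  shows "\<exists>t. meander_algorithm as = Some (meander_components as, t) \<and>
    t \<le> 100 * input_bits as * length as"
proof -
  let ?n = "length as" and ?b = "input_bits as"
  obtain t where t: "meander_iterate as (sum_list as) = Some (meander_components as, t)"
    "t \<le> 14 * weight ?n as"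
    using meander_iterate_correct[OF pos order_refl] by blast
  have n: "0 < ?n" "?n \<le> ?b" using assms length_le_input_bits by auto
  have "weight ?n as \<le> 2 * ?n * (2 * ?b + 1)"
    using weight_less[of as ?n] main_weight_le[of as] n
    by (meson add_le_mono1 less_imp_le mult_le_mono2 order.trans order_refl)
  also have "\<dots> \<le> 2 * ?n * (3 * ?b)" using n by (intro mult_le_mono2) linarith
  \<comment> \<open>The weight is at most \<open>6 * ?n * ?b\<close>, and 14 primitives per unit
    make 84; the initial sum adds at most one more \<open>?n * ?b\<close>, so 100 leaves
    room.\<close>
  finally have "?n + t \<le> ?n * 1 + 84 * (?n * ?b)" using t(2) by simp
  also have "\<dots> \<le> ?n * ?b + 84 * (?n * ?b)" using n by (intro add_le_mono1 mult_le_mono2) linarith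
  finally have "?n + t \<le> 100 * ?b * ?n" by (simp add: ac_simps)
  then show ?thesis
    by (simp add: meander_algorithm_def counted_sum_eq counted_bind_def t(1))
qed

theorem theorem6p2:
  shows
    "(\<forall>(a::nat) (xs::nat list) (c::nat) (\<alpha>::nat).
       (\<forall>x \<in> set (a # xs @ [c]). x > 0) \<longrightarrow> \<alpha> = sum_list (a # xs @ [c]) \<longrightarrow>
       meander_components (a # xs @ [c]) =
         (if a > c then
            meander_components (c # rev xs @ [a])
          else if a = c then
            meander_components xs + a
          else if a < c \<and> c < 2 * a then
            meander_components
              (remove_zeros (a mod (c - a) # xs @ [c - a + a mod (c - a)]))
          else if 2 * a = c then
            meander_components (xs @ [a])
          else if 2 * a < c \<and> real c < 2 / 3 * real \<alpha> then
            meander_components (xs @ [a, c - 2 * a])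
          else if 2 * (\<alpha> - c) dvd c then
            meander_components (a # xs)
          else
            meander_components (a # xs @ [c mod (2 * (\<alpha> - c))])))
     \<and>
     (\<exists>C::nat. \<forall>as::nat list.
       length as \<ge> 2 \<longrightarrow> (\<forall>x \<in> set as. x > 0) \<longrightarrow>
       (\<exists>t. meander_algorithm as = Some (meander_components as, t) \<and>
            t \<le> C * input_bits as * length as))"
proof (intro conjI allI impI)
  fix a c \<alpha> :: nat and xs :: "nat list"
  assume "\<forall>x \<in> set (a # xs @ [c]). x > 0" "\<alpha> = sum_list (a # xs @ [c])"
  then show "meander_components (a # xs @ [c]) =
         (if a > c then
            meander_components (c # rev xs @ [a])
          else if a = c then
            meander_components xs + a
          else if a < c \<and> c < 2 * a then
            meander_components
              (remove_zeros (a mod (c - a) # xs @ [c - a + a mod (c - a)]))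
          else if 2 * a = c then
            meander_components (xs @ [a])
          else if 2 * a < c \<and> real c < 2 / 3 * real \<alpha> then
            meander_components (xs @ [a, c - 2 * a])
          else if 2 * (\<alpha> - c) dvd c then
            meander_components (a # xs)
          else
            meander_components (a # xs @ [c mod (2 * (\<alpha> - c))]))"
    by (rule meander_components_recursion)
next
  show "\<exists>C::nat. \<forall>as::nat list.
       length as \<ge> 2 \<longrightarrow> (\<forall>x \<in> set as. x > 0) \<longrightarrow>
       (\<exists>t. meander_algorithm as = Some (meander_components as, t) \<and>
            t \<le> C * input_bits as * length as)"
    by (rule exI[of _ 100], intro allI impI, rule meander_algorithm_correct) auto
qed

end
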